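(* Assume that $P(x,y)>0$ for all $x,y\in X$ and that there is a constant $C_*\ge 1$ with $P_2(x,y)\le C_*P(x,y)$ for all $x,y\in X$; that $C_-:=\inf_{x\in X}P(x,x)>0$; that $\sup_{x,y\in X}P(x,y)/\mu(y)<\infty$; and that the potential $V$ is confining. Let $(A_n)_{n\in\mathbb N}$ be an exhausting sequence of subsets of $X$ such that $V$ is increasing with respect to $(A_n)_{n\in\mathbb N}$, let $\alpha$ be its first appearance function, and let $B\subset X$ be an arbitrary finite set. Then there exists a constant $\widetilde C>0$, independent of $n\in\mathbb N$ (and of $x,y$), such that the following estimates hold. (a) If $x\in B$ or $y\in B$, then for all $n\ge 1$ $$\widetilde C^{-1}\lambda_0^n\varphi_0(x)\widehat\varphi_0(y)\le u_n(x,y)\le \widetilde C\,\lambda_0^n\varphi_0(x)\widehat\varphi_0(y).$$ (b) If $x,y\in B^c$, then for all $n\ge 1$ $$\widetilde C^{-1}\Big(\lambda_0^n\varphi_0(x)\widehat\varphi_0(y)+C_{\mathrm{low}}^n F_n(x,y)\Big)\le u_n(x,y)\le \widetilde C\Big(\lambda_0^n\varphi_0(x)\widehat\varphi_0(y)+C_{\mathrm{up}}^n F_n(x,y)\Big),$$ where $C_{\mathrm{up}}=\max\{3C_*,C_-^{-1}\}$, $C_{\mathrm{low}}=\min\{C_*^{-1},C_-\}$ and $$F_n(x,y)=\frac1{V(x)}\sum_{z\in B^c\cap A_{\alpha(x)}\cap A_{\alpha(y)}}p(x,z)\,p(z,y)\,\frac1{V(z)^{n-1}}\,\mu(z).$$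 In particular, $u_n(x,y)\ge \widetilde C^{-1}\lambda_0^n\varphi_0(x)\widehat\varphi_0(y)$ for all $x,y\in X$ and $n\ge1$.
   Context: $X$ is a countably infinite set, $\mathbb N=\{1,2,\dots\}$. $P:X\times X\to[0,1]$ is a (sub-)probability kernel, i.e. $\sum_{y\in X}P(x,y)\le1$ for all $x$. It is assumed throughout that there are a (sub-)probability kernel $\widehat P:X\times X\to[0,1]$ and a measure $\mu:X\to(0,\infty)$ with $\mu(x)P(x,y)=\mu(y)\widehat P(y,x)$ for all $x,y\in X$. Put $p(x,y)=P(x,y)/\mu(y)$ and $P_2(x,y)=\sum_{z\in X}P(x,z)P(z,y)$. A potential is a function $V:X\to(0,\infty)$ with $\inf_{x\in X}V(x)>0$ (standing assumption). It is confining if for every $M\in\mathbb N$ there is a finite set $B_M\subset X$ with $V(x)\ge M$ for all $x\in X\setminus B_M$. Let $\mathcal U f(x)=\frac1{V(x)}\sum_{y}P(x,y)f(y)$ and $\widehat{\mathcal U}f(x)=\sum_y\widehat P(x,y)\frac1{V(y)}f(y)$; these are mutually adjoint on $\ell^2(\mu)$. Let $\mathcal U_n=\mathcal U^n$. It has kernel $u_n$ with respect to $\mu$: $\mathcal U_nf(x)=\sum_yu_n(x,y)f(y)\mu(y)$, where $u_1(x,y)=p(x,y)/V(x)$ and $u_{n+1}(x,y)=\sum_zu_n(x,z)u_1(z,y)\mu(z)$. Under the hypotheses of the claim, $\mathcal U,\widehat{\mathcal U}$ are compact on $\ell^2(\mu)$ and $\lambda_0:=\sup_{\lambda\in\sigma(\mathcal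 U)}|\lambda|=\sup_{\lambda\in\sigma(\widehat{\mathcal U})}|\lambda|>0$ is a simple eigenvalue of both; $\varphi_0,\widehat\varphi_0$ denote the corresponding strictly positive eigenfunctions (ground states), $\mathcal U\varphi_0=\lambda_0\varphi_0$, $\widehat{\mathcal U}\widehat\varphi_0=\lambda_0\widehat\varphi_0$, normalized by $\|\varphi_0\|_{\ell^2(\mu)}=\|\widehat\varphi_0\|_{\ell^2(\mu)}=1$. A sequence $(A_n)_{n\in\mathbb N}$ of subsets of $X$ is exhausting if $A_n\subseteq A_{n+1}$ and $\bigcup_nA_n=X$. Its first appearance function is $\alpha(x)=\min\{n\in\mathbb N:x\in A_n\}$. $V$ is increasing with respect to $(A_n)$ if $V(x)\le V(y)$ whenever $\alpha(x)<\alpha(y)$. *)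

theory Defs
  imports "HOL-Analysis.Analysis"
begin

definition subprob_kernel :: "('a \<Rightarrow> 'a \<Rightarrow> real) \<Rightarrow> bool" where
  "subprob_kernel P \<longleftrightarrow>
     (\<forall>x y. P x y \<in> {0..1}) \<and> (\<forall>x. P x summable_on UNIV \<and> (\<Sum>\<^sub>\<infinity>y. P x y) \<le> 1)"

definition dens :: "('a \<Rightarrow> real) \<Rightarrow> ('a \<Rightarrow> 'a \<Rightarrow> real) \<Rightarrow> 'a \<Rightarrow> 'a \<Rightarrow> real" where
  "dens \<mu> P x y = P x y / \<mu> y"

definition two_step :: "('a \<Rightarrow> 'a \<Rightarrow> real) \<Rightarrow> 'a \<Rightarrow> 'a \<Rightarrow> real" where
  "two_step P x y = (\<Sum>\<^sub>\<infinity>z. P x z * P z y)"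

definition inf_diag :: "('a \<Rightarrow> 'a \<Rightarrow> real) \<Rightarrow> real" where
  "inf_diag P = (INF x. P x x)"

definition potential :: "('a \<Rightarrow> real) \<Rightarrow> bool" where
  "potential V \<longleftrightarrow> (\<forall>x. V x > 0) \<and> (INF x. V x) > 0"

definition confining :: "('a \<Rightarrow> real) \<Rightarrow> bool" where
  "confining V \<longleftrightarrow> (\<forall>M::nat. M \<ge> 1 \<longrightarrow> (\<exists>B. finite B \<and> (\<forall>x\<in>- B. V x \<ge> real M)))"

text \<open>The operators act on scalar functions of either kind: the spectrum is taken over the
  complex scalars, whereas the ground states are real-valued.\<close>

definition feynman_kac ::
    "('a \<Rightarrow> 'a \<Rightarrow> real) \<Rightarrow> ('a \<Rightarrow> real) \<Rightarrow> ('a \<Rightarrow> 'b::real_normed_field) \<Rightarrow> 'a \<Rightarrow> 'b" where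
  "feynman_kac P V f x = of_real (1 / V x) * (\<Sum>\<^sub>\<infinity>y. of_real (P x y) * f y)"

definition feynman_kac_dual ::
    "('a \<Rightarrow> 'a \<Rightarrow> real) \<Rightarrow> ('a \<Rightarrow> real) \<Rightarrow> ('a \<Rightarrow> 'b::real_normed_field) \<Rightarrow> 'a \<Rightarrow> 'b" where
  "feynman_kac_dual Phat V f x = (\<Sum>\<^sub>\<infinity>y. of_real (Phat x y) * of_real (1 / V y) * f y)"

text \<open>Kernel of the \<open>n\<close>-th power with respect to \<open>\<mu>\<close>.  Only \<open>n \<ge> 1\<close> is of interest;
  \<open>n = 0\<close> is given the kernel of the identity.\<close>

fun fk_kernel :: "('a \<Rightarrow> real) \<Rightarrow> ('a \<Rightarrow> 'a \<Rightarrow> real) \<Rightarrow> ('a \<Rightarrow> real) \<Rightarrow> nat \<Rightarrow> 'a \<Rightarrow> 'a \<Rightarrow> real" where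
  "fk_kernel \<mu> P V 0 x y = (if x = y then 1 / \<mu> y else 0)"
| "fk_kernel \<mu> P V (Suc 0) x y = dens \<mu> P x y / V x"
| "fk_kernel \<mu> P V (Suc (Suc n)) x y =
     (\<Sum>\<^sub>\<infinity>z. fk_kernel \<mu> P V (Suc n) x z * fk_kernel \<mu> P V (Suc 0) z y * \<mu> z)"

definition l2 :: "('a \<Rightarrow> real) \<Rightarrow> ('a \<Rightarrow> 'b::real_normed_field) set" where
  "l2 \<mu> = {f. (\<lambda>x. (norm (f x))\<^sup>2 * \<mu> x) summable_on UNIV}"

definition l2_norm :: "('a \<Rightarrow> real) \<Rightarrow> ('a \<Rightarrow> 'b::real_normed_field) \<Rightarrow> real" where
  "l2_norm \<mu> f = sqrt (\<Sum>\<^sub>\<infinity>x. (norm (f x))\<^sup>2 * \<mu> x)"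

text \<open>\<open>z\<close> is in the spectrum unless \<open>z - T\<close> is a bijection of the complex space \<open>l2 \<mu>\<close>
  with bounded inverse.\<close>

definition l2_spectrum ::
    "('a \<Rightarrow> real) \<Rightarrow> (('a \<Rightarrow> complex) \<Rightarrow> 'a \<Rightarrow> complex) \<Rightarrow> complex set" where
  "l2_spectrum \<mu> T = {z. \<not> (bij_betw (\<lambda>f x. z * f x - T f x) (l2 \<mu>) (l2 \<mu>) \<and>
     (\<exists>c. \<forall>f\<in>l2 \<mu>. l2_norm \<mu> f \<le> c * l2_norm \<mu> (\<lambda>x. z * f x - T f x)))}"

definition l2_spectral_radius ::
    "('a \<Rightarrow> real) \<Rightarrow> (('a \<Rightarrow> complex) \<Rightarrow> 'a \<Rightarrow> complex) \<Rightarrow> real" where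
  "l2_spectral_radius \<mu> T = (SUP z\<in>l2_spectrum \<mu> T. cmod z)"

definition ground_state ::
    "('a \<Rightarrow> real) \<Rightarrow> (('a \<Rightarrow> real) \<Rightarrow> 'a \<Rightarrow> real) \<Rightarrow> real \<Rightarrow> ('a \<Rightarrow> real) \<Rightarrow> bool" where
  "ground_state \<mu> T r \<phi> \<longleftrightarrow>
     \<phi> \<in> l2 \<mu> \<and> l2_norm \<mu> \<phi> = 1 \<and> (\<forall>x. \<phi> x > 0) \<and> (\<forall>x. T \<phi> x = r * \<phi> x)"

text \<open>Sequences of sets are indexed by the positive integers; the value at \<open>0\<close> is ignored.\<close>

definition exhausting :: "(nat \<Rightarrow> 'a set) \<Rightarrow> bool" where
  "exhausting A \<longleftrightarrow> (\<forall>n\<ge>1. A n \<subseteq> A (Suc n)) \<and> (\<Union>n\<in>{1..}. A n) = UNIV"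

definition first_appearance :: "(nat \<Rightarrow> 'a set) \<Rightarrow> 'a \<Rightarrow> nat" where
  "first_appearance A x = (LEAST n. n \<ge> 1 \<and> x \<in> A n)"

definition increasing_wrt :: "(nat \<Rightarrow> 'a set) \<Rightarrow> ('a \<Rightarrow> real) \<Rightarrow> bool" where
  "increasing_wrt A V \<longleftrightarrow>
     (\<forall>x y. first_appearance A x < first_appearance A y \<longrightarrow> V x \<le> V y)"

definition F_term ::
    "('a \<Rightarrow> real) \<Rightarrow> ('a \<Rightarrow> 'a \<Rightarrow> real) \<Rightarrow> ('a \<Rightarrow> real) \<Rightarrow> (nat \<Rightarrow> 'a set) \<Rightarrow> 'a set \<Rightarrow>
      nat \<Rightarrow> 'a \<Rightarrow> 'a \<Rightarrow> real" where
  "F_term \<mu> P V A B n x y = 1 / V x *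
     (\<Sum>\<^sub>\<infinity>z \<in> - B \<inter> A (first_appearance A x) \<inter> A (first_appearance A y).
        dens \<mu> P x z * dens \<mu> P z y * (1 / V z ^ (n - 1)) * \<mu> z)"

end

theory Submission
  imports Defs
begin

text \<open>
  Work with the kernel \<open>Q x y = P x y / V x\<close> with respect to counting measure; its \<open>n\<close>-th power
  is \<open>u n x y * \<mu> y\<close>.  Since \<open>V\<close> is confining and \<open>P\<^sub>2 \<le> C P\<close>, the eigenvalue equation shows that
  \<open>\<phi> x\<close> is comparable to \<open>P x b / V x\<close> for every fixed \<open>b\<close>, and dually for the left ground state.
  So \<open>u 1\<close> dominates a multiple of the product of the ground states, and for \<open>x \<in> B\<close> or \<open>y \<in> B\<close> it
  is also dominated by one; both bounds propagate to all \<open>n\<close> by the eigenvalue equations.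

  Off \<open>B\<close>, the paths that jump to a site \<open>z\<close>, stay there and then jump to \<open>y\<close> give the lower bound
  by \<open>F\<close>.  For the upper bound, consider the sum of the weights of these paths over all \<open>z \<notin> B\<close>, plus
  \<open>P x y / min (V x) (V y) ^ (n - 1)\<close>, all divided by \<open>V x\<close>.  Comparing \<open>V\<close> at the two sites involved,
  one sees that an application of \<open>Q\<close> maps this majorant to at most \<open>3 C\<close> times its successor.  As \<open>V\<close>
  increases along the exhaustion, the extra term and the sites beyond \<open>x\<close> or \<open>y\<close> are absorbed by \<open>F\<close>.
\<close>

section \<open>Kernels with values in the extended nonnegative reals\<close>

text \<open>\<open>infsum\<close> takes the default value 0 on families that are not summable.
  Finiteness of the integral rules this case out.\<close>

lemma ennreal_infsum_if_nn_integral_finite: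
  fixes f :: "'a \<Rightarrow> real"
  assumes nonneg: "\<And>x. f x \<ge> 0" and finite: "(\<integral>\<^sup>+x. ennreal (f x) \<partial>count_space UNIV) < top"
  shows "ennreal (\<Sum>\<^sub>\<infinity>x. f x) = (\<integral>\<^sup>+x. ennreal (f x) \<partial>count_space UNIV)"
proof -
  have *: "Infinite_Set_Sum.abs_summable_on f UNIV"
    unfolding abs_summable_on_def using assms by (intro integrableI_nonneg) auto
  show ?thesis
    using nn_integral_conv_infsetsum[OF *] infsetsum_infsum[OF *] nonneg by simp
qed

lemma ennreal_infsum:
  fixes f :: "'a \<Rightarrow> real"
  assumes "\<And>x. f x \<ge> 0" "f summable_on UNIV"
  shows "ennreal (\<Sum>\<^sub>\<infinity>x. f x) = (\<integral>\<^sup>+x. ennreal (f x) \<partial>count_space UNIV)"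
proof -
  have "Infinite_Set_Sum.abs_summable_on f UNIV"
    using summable_on_iff_abs_summable_on_real[of f UNIV] abs_summable_equivalent[of f UNIV] assms(2)
    by blast
  then show ?thesis
    using nn_integral_conv_infsetsum[of f UNIV] infsetsum_infsum[of f UNIV] assms(1) by metis
qed

text \<open>Over \<open>ennreal\<close> all sums exist and may be interchanged. Composition of
  kernels needs no definition of its own: it is \<open>kapp\<close> of the first kernel applied to a
  column of the second.\<close>

definition kapp :: "('a \<Rightarrow> 'b \<Rightarrow> ennreal) \<Rightarrow> ('b \<Rightarrow> ennreal) \<Rightarrow> 'a \<Rightarrow> ennreal" where
  "kapp K f x = (\<integral>\<^sup>+z. K x z * f z \<partial>count_space UNIV)"

lemma kapp_mono: "(\<And>z. f z \<le> g z) \<Longrightarrow> kapp K f x \<le> kapp K g x"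
  unfolding kapp_def by (intro nn_integral_mono mult_left_mono) auto

lemma kapp_cmult: "kapp K (\<lambda>z. c * f z) x = c * kapp K f x"
  by (simp add: kapp_def nn_integral_cmult[symmetric] mult.left_commute)

lemma kapp_add: "kapp K (\<lambda>z. f z + g z) x = kapp K f x + kapp K g x"
  unfolding kapp_def distrib_left by (rule nn_integral_add) simp_all

lemma kapp_weight: "kapp (\<lambda>x y. w x * K x y) f x = w x * kapp K f x"
  by (simp add: kapp_def nn_integral_cmult[symmetric] mult.assoc)

lemma kapp_ge_point: "K x z * f z \<le> kapp K f x"
  unfolding kapp_def by (rule nn_integral_ge_point) simp

text \<open>Tonelli for counting measures; this is the associativity behind
  \<open>kpow_Suc_left\<close>.\<close>

lemma kapp_kapp: "kapp K (kapp L f) x = kapp (\<lambda>x y. kapp K (\<lambda>z. L z y) x) f x"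
proof -
  have "kapp K (kapp L f) x =
    (\<integral>\<^sup>+z. \<integral>\<^sup>+y. (\<lambda>(z, y). K x z * L z y * f y) (z, y) \<partial>count_space UNIV \<partial>count_space UNIV)"
    by (simp add: kapp_def nn_integral_cmult[symmetric] mult.assoc)
  also have "\<dots> = (\<integral>\<^sup>+y. \<integral>\<^sup>+z. (\<lambda>(z, y). K x z * L z y * f y) (z, y) \<partial>count_space UNIV \<partial>count_space UNIV)"
    by (simp only: nn_integral_fst_count_space nn_integral_snd_count_space)
  also have "\<dots> = kapp (\<lambda>x y. kapp K (\<lambda>z. L z y) x) f x"
    by (simp add: kapp_def nn_integral_multc[symmetric])
  finally show ?thesis .
qed

text \<open>The index is shifted: \<open>kpow K n\<close> is the kernel of the \<open>(n + 1)\<close>-st power.\<close>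

primrec kpow :: "('a \<Rightarrow> 'a \<Rightarrow> ennreal) \<Rightarrow> nat \<Rightarrow> 'a \<Rightarrow> 'a \<Rightarrow> ennreal" where
  "kpow K 0 = K"
| "kpow K (Suc n) = (\<lambda>x y. kapp (kpow K n) (\<lambda>z. K z y) x)"

lemma kpow_Suc_left: "kpow K (Suc n) x y = kapp K (\<lambda>z. kpow K n z y) x"
proof (induction n arbitrary: x y)
  case (Suc n)
  have "kpow K (Suc (Suc n)) x y = kapp (kpow K (Suc n)) (\<lambda>z. K z y) x" by simp
  also have "\<dots> = kapp (\<lambda>x y. kapp K (\<lambda>z. kpow K n z y) x) (\<lambda>z. K z y) x"
    using Suc by (simp add: kapp_def)
  also have "\<dots> = kapp K (\<lambda>z. kpow K (Suc n) z y) x"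
    by (simp add: kapp_kapp)
  finally show ?case .
qed simp

text \<open>Lets estimates for right eigenfunctions be reused for left ones: a step added on the
  left of the transposed kernel is a step added on the right of the original.\<close>

lemma kpow_transpose: "kpow (\<lambda>x y. K y x) n x y = kpow K n y x"
proof (induction n arbitrary: x y)
  case (Suc n)
  then show ?case
    by (subst kpow_Suc_left) (simp add: kapp_def mult.commute)
qed simp

text \<open>With \<open>y\<close> fixed, the column of \<open>K\<close> starts below a multiple of
  \<open>f\<close>, and each further step on the left costs at most a factor \<open>l\<close>. The
  factor \<open>a\<close> avoids division in \<open>ennreal\<close>.\<close>

lemma kpow_le:
  assumes "\<And>x. a * K x y \<le> c * f x" "\<And>x. kapp K f x \<le> l * f x"
  shows "a * kpow K n x y \<le> c * l ^ n * f x"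
proof (induction n arbitrary: x)
  case (Suc n)
  have "a * kpow K (Suc n) x y \<le> kapp K (\<lambda>z. c * l ^ n * f z) x"
    unfolding kpow_Suc_left kapp_cmult[symmetric] by (intro kapp_mono Suc)
  also have "\<dots> \<le> c * l ^ n * (l * f x)"
    unfolding kapp_cmult by (intro mult_left_mono assms) auto
  finally show ?case by (simp add: mult_ac)
qed (use assms in simp)

lemma kpow_ge:
  assumes "\<And>x. c * f x \<le> a * K x y" "\<And>x. l * f x \<le> kapp K f x"
  shows "c * l ^ n * f x \<le> a * kpow K n x y"
proof (induction n arbitrary: x)
  case (Suc n)
  have "c * l ^ n * (l * f x) \<le> kapp K (\<lambda>z. c * l ^ n * f z) x"
    unfolding kapp_cmult by (intro mult_left_mono assms) auto
  also have "\<dots> \<le> a * kpow K (Suc n) x y"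
    unfolding kpow_Suc_left kapp_cmult[symmetric] by (intro kapp_mono Suc)
  finally show ?case by (simp add: mult_ac)
qed (use assms in simp)

text \<open>Keeps only the path that stays at \<open>z\<close> for \<open>n\<close> steps and then
  jumps to \<open>y\<close>.\<close>

lemma kpow_ge_diag:
  assumes "\<And>z. d z \<le> K z z"
  shows "d z ^ n * K z y \<le> kpow K n z y"
proof (induction n)
  case (Suc n)
  have "d z ^ Suc n * K z y = d z * (d z ^ n * K z y)" by (simp add: mult_ac)
  also have "\<dots> \<le> K z z * kpow K n z y"
    by (intro mult_mono assms Suc) auto
  also have "\<dots> \<le> kpow K (Suc n) z y"
    unfolding kpow_Suc_left by (rule kapp_ge_point)
  finally show ?case .
qed simp

section \<open>Kernels with the direct step property\<close>

locale direct_step =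
  fixes P :: "'a \<Rightarrow> 'a \<Rightarrow> ennreal" and C :: ennreal
  assumes two_step: "kapp P (\<lambda>z. P z y) x \<le> C * P x y"
begin

lemma direct_step_transpose: "direct_step (\<lambda>x y. P y x) C"
  using two_step by unfold_locales (simp add: kapp_def mult.commute)

lemma kapp_two_step: "kapp P (kapp P f) x \<le> C * kapp P f x"
proof -
  have "kapp P (kapp P f) x \<le> kapp (\<lambda>x y. C * P x y) f x"
    unfolding kapp_kapp using two_step unfolding kapp_def
    by (intro nn_integral_mono mult_right_mono) auto
  also have "\<dots> = C * kapp P f x" by (rule kapp_weight)
  finally show ?thesis .
qed

text \<open>With \<open>w = 1 / V\<close>, one more factor \<open>w x\<close> and \<open>S\<close>
  the summation set of \<open>F_term\<close>, this is \<open>F_term\<close> at index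
  \<open>Suc n\<close> times \<open>\<mu> y\<close>.\<close>

definition loops :: "('a \<Rightarrow> ennreal) \<Rightarrow> 'a set \<Rightarrow> nat \<Rightarrow> 'a \<Rightarrow> 'a \<Rightarrow> ennreal" where
  "loops w S n x y = kapp P (\<lambda>z. indicator S z * w z ^ n * P z y) x"

text \<open>The summand with \<open>P x y\<close> makes the majorant dominate the one-step kernel at
  \<open>n = 0\<close>.\<close>

definition majorant :: "('a \<Rightarrow> ennreal) \<Rightarrow> 'a set \<Rightarrow> nat \<Rightarrow> 'a \<Rightarrow> 'a \<Rightarrow> ennreal" where
  "majorant w S n x y = w x * (loops w S n x y + P x y * max (w x) (w y) ^ n)"

text \<open>In the product of \<open>w z\<close> and \<open>w t ^ n\<close> the heavier of the two
  sites may take all \<open>n + 1\<close> powers. The other site then carries no weight and is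
  removed by the two-step bound. Each of the two cases contributes one \<open>C\<close>.\<close>

lemma kapp_loops:
  "kapp P (\<lambda>z. indicator S z * w z * loops w S n z y) x \<le> 2 * C * loops w S (Suc n) x y"
proof -
  define g where "g n z = indicator S z * w z ^ n" for n z
  have "indicator S z * w z * loops w S n z y
      \<le> kapp P (\<lambda>t. g (Suc n) t * P t y) z + g (Suc n) z * kapp P (\<lambda>t. P t y) z" for z
  proof -
    have pt: "indicator S z * w z * g n t \<le> g (Suc n) t + g (Suc n) z" for t
    proof (cases "w z \<le> w t")
      case True
      then have "w z * w t ^ n \<le> w t ^ Suc n"
        by (simp add: mult_right_mono)
      then show ?thesis by (auto simp: g_def indicator_def intro: add_increasing2)
    next
      case False
      then have "w z * w t ^ n \<le> w z ^ Suc n"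
        by (auto intro!: mult_left_mono power_mono)
      then show ?thesis by (auto simp: g_def indicator_def intro: add_increasing)
    qed
    have "indicator S z * w z * loops w S n z y
        = kapp P (\<lambda>t. (indicator S z * w z * g n t) * P t y) z"
      unfolding loops_def g_def kapp_cmult[symmetric] by (simp add: mult_ac)
    also have "\<dots> \<le> kapp P (\<lambda>t. (g (Suc n) t + g (Suc n) z) * P t y) z"
      by (intro kapp_mono mult_right_mono pt) auto
    also have "\<dots> = kapp P (\<lambda>t. g (Suc n) t * P t y) z + g (Suc n) z * kapp P (\<lambda>t. P t y) z"
      by (simp add: kapp_add kapp_cmult distrib_right)
    finally show ?thesis .
  qed
  then have "kapp P (\<lambda>z. indicator S z * w z * loops w S n z y) x
      \<le> kapp P (\<lambda>z. kapp P (\<lambda>t. g (Suc n) t * P t y) z + g (Suc n) z * kapp P (\<lambda>t. P t y) z) x"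
    by (rule kapp_mono)
  also have "\<dots> \<le> kapp P (\<lambda>z. kapp P (\<lambda>t. g (Suc n) t * P t y) z + C * (g (Suc n) z * P z y)) x"
    by (intro kapp_mono add_left_mono) (metis mult.left_commute mult_left_mono two_step zero_le)
  also have "\<dots> \<le> C * loops w S (Suc n) x y + C * loops w S (Suc n) x y"
    unfolding kapp_add kapp_cmult loops_def g_def[symmetric]
    by (intro add_right_mono kapp_two_step)
  finally show ?thesis by (simp add: mult_2 distrib_right mult.assoc)
qed

text \<open>The constant 3 counts the two contributions of \<open>kapp_loops\<close> and one from
  the term with \<open>P x y\<close>.\<close>

lemma kapp_majorant:
  assumes "1 \<le> C"
  shows "kapp (\<lambda>x y. w x * P x y) (\<lambda>z. indicator S z * majorant w S n z y) x
    \<le> 3 * C * majorant w S (Suc n) x y"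
proof -
  \<comment> \<open>If \<open>z\<close> is heavier than \<open>y\<close>, the direct jump from
    \<open>z\<close> becomes a loop term at \<open>z\<close>; otherwise all powers go to
    \<open>w y\<close>, and the site \<open>z\<close> can be summed out.\<close>
  have pt: "indicator S z * w z * (P z y * max (w z) (w y) ^ n)
      \<le> indicator S z * w z ^ Suc n * P z y + w y ^ Suc n * P z y" for z
  proof (cases "w y \<le> w z")
    case True
    then show ?thesis by (auto simp: max_absorb1 mult_ac intro: add_increasing2)
  next
    case False
    then have "w z * w y ^ n \<le> w y ^ Suc n" by (simp add: mult_right_mono)
    then have "indicator S z * w z * (P z y * max (w z) (w y) ^ n) \<le> w y ^ Suc n * P z y"
      using False by (auto simp: max_absorb2 indicator_def mult_ac intro: mult_left_mono)
        (metis mult.left_commute mult_left_mono zero_le)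
    then show ?thesis by (auto intro: add_increasing)
  qed
  have "kapp P (\<lambda>z. indicator S z * majorant w S n z y) x
     = kapp P (\<lambda>z. indicator S z * w z * loops w S n z y) x
       + kapp P (\<lambda>z. indicator S z * w z * (P z y * max (w z) (w y) ^ n)) x"
    by (simp add: majorant_def kapp_add[symmetric] distrib_left mult_ac)
  also have "\<dots> \<le> 2 * C * loops w S (Suc n) x y
      + kapp P (\<lambda>z. indicator S z * w z ^ Suc n * P z y + w y ^ Suc n * P z y) x"
    by (intro add_mono kapp_loops kapp_mono pt)
  also have "\<dots> \<le> 2 * C * loops w S (Suc n) x y
      + (C * loops w S (Suc n) x y + max (w x) (w y) ^ Suc n * (C * P x y))"
    unfolding kapp_add kapp_cmult
  proof (intro add_mono mult_mono two_step order_refl power_mono)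
    show "kapp P (\<lambda>z. indicator S z * w z ^ Suc n * P z y) x \<le> C * loops w S (Suc n) x y"
      using mult_right_mono[OF assms] unfolding loops_def by fastforce
  qed auto
  also have "\<dots> \<le> 3 * C * (loops w S (Suc n) x y + P x y * max (w x) (w y) ^ Suc n)"
  proof -
    have "max (w x) (w y) ^ Suc n * (C * P x y) \<le> 3 * C * (P x y * max (w x) (w y) ^ Suc n)"
      using mult_right_mono[of 1 3 "C * (P x y * max (w x) (w y) ^ Suc n)"] by (simp add: mult_ac)
    moreover have "2 * C * t + C * t = 3 * C * t" for t :: ennreal
      by (metis distrib_right mult_1 numeral_plus_one semiring_norm(5))
    ultimately show ?thesis
      by (metis (no_types, lifting) add.assoc add_left_mono distrib_left)
  qed
  finally show ?thesis
    unfolding kapp_weight majorant_def mult.left_commute[of "3 * C"] by (rule mult_left_mono) simp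
qed

text \<open>Induction on the first step, applied only to starting points in \<open>S\<close>;
  outside \<open>S\<close> the bound is assumed. The indicator therefore survives inside the sum,
  and the \<open>f\<close> term reproduces itself because \<open>f\<close> is superharmonic up to
  \<open>l\<close>.\<close>

lemma kpow_le_majorant:
  assumes "1 \<le> C"
    and on_B: "\<And>n x. x \<notin> S \<Longrightarrow> kpow (\<lambda>x y. w x * P x y) n x y \<le> D * l ^ n * f x"
    and f: "\<And>x. kapp (\<lambda>x y. w x * P x y) f x \<le> l * f x"
  shows "kpow (\<lambda>x y. w x * P x y) n x y
    \<le> D * l ^ n * f x + (3 * C) ^ n * (indicator S x * majorant w S n x y)"
proof (induction n arbitrary: x)
  case 0
  show ?case
  proof (cases "x \<in> S")
    case True
    have "w x * P x y \<le> majorant w S 0 x y"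
      by (simp add: majorant_def distrib_left)
    then show ?thesis using True by (auto intro: add_increasing)
  next
    case False
    then show ?thesis using on_B[of x 0] by simp
  qed
next
  case (Suc n)
  show ?case
  proof (cases "x \<in> S")
    case True
    have "kpow (\<lambda>x y. w x * P x y) (Suc n) x y \<le> kapp (\<lambda>x y. w x * P x y)
        (\<lambda>z. D * l ^ n * f z + (3 * C) ^ n * (indicator S z * majorant w S n z y)) x"
      unfolding kpow_Suc_left by (intro kapp_mono Suc)
    also have "\<dots> \<le> D * l ^ n * (l * f x) + (3 * C) ^ n * (3 * C * majorant w S (Suc n) x y)"
      unfolding kapp_add kapp_cmult by (intro add_mono mult_left_mono f kapp_majorant assms) auto
    finally show ?thesis using True by (simp add: mult_ac)
  next
    case False
    then show ?thesis using on_B[of x "Suc n"] by simp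
  qed
qed

text \<open>Sites of \<open>S - R\<close> have weight at most that of \<open>x\<close> or
  \<open>y\<close>, so the two-step bound merges them into the term with \<open>P x y\<close>. That
  term in turn is one summand of \<open>loops w R\<close>, up to the diagonal bound
  \<open>c\<close>.\<close>

lemma majorant_le_loops:
  assumes "R \<subseteq> S" and "\<And>z. z \<in> S - R \<Longrightarrow> w z \<le> max (w x) (w y)"
    and s: "s \<in> R" "s = x \<or> s = y" "w s = max (w x) (w y)" and c: "\<And>z. c \<le> P z z"
  shows "c * majorant w S n x y \<le> (c + C + 1) * (w x * loops w R n x y)"
proof -
  \<comment> \<open>Take the site \<open>s\<close> itself: as it equals \<open>x\<close> or
    \<open>y\<close>, one of the two jumps through \<open>s\<close> is a diagonal one, with
    probability at least \<open>c\<close>.\<close>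
  have peak: "c * (P x y * max (w x) (w y) ^ n) \<le> loops w R n x y"
  proof -
    have "c * (P x y * max (w x) (w y) ^ n) \<le> P x s * (indicator R s * w s ^ n * P s y)"
      using s c[of s] by (auto simp: mult_ac intro!: mult_left_mono mult_right_mono)
    also have "\<dots> \<le> loops w R n x y" unfolding loops_def by (rule kapp_ge_point)
    finally show ?thesis .
  qed
  have "loops w S n x y \<le> kapp P (\<lambda>z. indicator R z * w z ^ n * P z y + max (w x) (w y) ^ n * P z y) x"
    unfolding loops_def
  proof (rule kapp_mono)
    fix z show "indicator S z * w z ^ n * P z y
      \<le> indicator R z * w z ^ n * P z y + max (w x) (w y) ^ n * P z y"
    proof (cases "z \<in> S - R")
      case True
      then have "w z ^ n * P z y \<le> max (w x) (w y) ^ n * P z y"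
        using assms(2) by (intro mult_right_mono power_mono) auto
      then show ?thesis using True by simp
    next
      case False
      then have "indicator S z = (indicator R z :: ennreal)"
        using assms(1) by (auto simp: indicator_def)
      then show ?thesis by (simp add: add_increasing2)
    qed
  qed
  also have "\<dots> \<le> loops w R n x y + C * (P x y * max (w x) (w y) ^ n)"
    unfolding kapp_add kapp_cmult loops_def
    using mult_left_mono[OF two_step[of y x], of "max (w x) (w y) ^ n"] by (simp add: mult_ac add_left_mono)
  finally have "c * loops w S n x y \<le> c * (loops w R n x y + C * (P x y * max (w x) (w y) ^ n))"
    by (rule mult_left_mono) simp
  also have "\<dots> = c * loops w R n x y + C * (c * (P x y * max (w x) (w y) ^ n))"
    by (simp add: distrib_left mult.left_commute)
  also have "\<dots> \<le> c * loops w R n x y + C * loops w R n x y"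
    by (intro add_left_mono mult_left_mono peak) auto
  finally have "c * loops w S n x y + c * (P x y * max (w x) (w y) ^ n)
      \<le> (c + C + 1) * loops w R n x y"
    using peak by (simp add: distrib_right add_mono)
  then show ?thesis
    unfolding majorant_def mult.left_commute[of _ "w x"] distrib_left[of c] by (rule mult_left_mono) simp
qed

text \<open>Of the \<open>n + 2\<close> steps, the first goes to \<open>z\<close>, then
  \<open>n\<close> stay there and the last goes to \<open>y\<close>. Only the \<open>n\<close> stays
  cost a factor \<open>c\<close>, while all \<open>n + 1\<close> departures from \<open>z\<close>
  contribute \<open>w z\<close>.\<close>

lemma loops_le_kpow:
  assumes "\<And>z. c \<le> P z z"
  shows "c ^ n * (w x * loops w S (Suc n) x y) \<le> kpow (\<lambda>x y. w x * P x y) (Suc n) x y"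
proof -
  have "c ^ n * loops w S (Suc n) x y \<le> kapp P (\<lambda>z. kpow (\<lambda>x y. w x * P x y) n z y) x"
    unfolding loops_def kapp_cmult[symmetric]
  proof (rule kapp_mono)
    fix z
    have "c ^ n * (indicator S z * w z ^ Suc n * P z y) \<le> (w z * c) ^ n * (w z * P z y)"
      by (auto simp: indicator_def power_mult_distrib mult_ac)
    also have "\<dots> \<le> kpow (\<lambda>x y. w x * P x y) n z y"
      by (rule kpow_ge_diag[where K = "\<lambda>x y. w x * P x y" and d = "\<lambda>z. w z * c"])
        (intro mult_left_mono assms, simp)
    finally show "c ^ n * (indicator S z * w z ^ Suc n * P z y) \<le> kpow (\<lambda>x y. w x * P x y) n z y" .
  qed
  then show ?thesis
    unfolding kpow_Suc_left kapp_weight by (metis mult.left_commute mult_left_mono zero_le)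
qed

text \<open>At index 0 a single step has to dominate two jumps, so the direct step property replaces
  the path argument.\<close>

lemma loops_0_le: "w x * loops w S 0 x y \<le> C * (w x * P x y)"
proof -
  have "loops w S 0 x y \<le> kapp P (\<lambda>z. P z y) x"
    unfolding loops_def by (intro kapp_mono) (auto simp: indicator_def)
  then show ?thesis using two_step by (metis mult.left_commute mult_left_mono order_trans zero_le)
qed

end

section \<open>Comparison with the ground states\<close>

lemma ennreal_le_divide:
  fixes a b c :: ennreal
  assumes "a * b \<le> c" "0 < a" "a < top"
  shows "b \<le> c / a"
  using divide_right_mono_ennreal[OF assms(1), of a] assms(2,3)
  by (metis less_irrefl mult.commute mult_divide_eq_ennreal)

text \<open>Here \<open>w\<close> stands for \<open>1 / V\<close>, \<open>vanishing\<close> for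
  confinement, and \<open>g\<close> is a left eigenvector for counting measure, that is, the dual
  ground state times \<open>\<mu>\<close>.\<close>

locale positive_ground_state = direct_step P C
  for P :: "'a \<Rightarrow> 'a \<Rightarrow> ennreal" and C +
  fixes w :: "'a \<Rightarrow> ennreal" and l :: ennreal and f g :: "'a \<Rightarrow> ennreal"
  assumes C: "1 \<le> C" "C < top"
    and P: "\<And>x y. 0 < P x y" "\<And>x y. P x y < top"
    and w: "\<And>x. 0 < w x" "\<And>x. w x < top"
    and l: "0 < l" "l < top"
    and f: "\<And>x. 0 < f x" "\<And>x. f x < top"
    and g: "\<And>x. 0 < g x" "\<And>x. g x < top"
    and right: "\<And>x. kapp (\<lambda>x y. w x * P x y) f x = l * f x"
    and left: "\<And>y. kapp (\<lambda>y x. w x * P x y) g y = l * g y"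
    and vanishing: "\<And>e. 0 < e \<Longrightarrow> finite {z. e < w z}"
begin

abbreviation "Q \<equiv> \<lambda>x y. w x * P x y"

lemma kpow_le_ground: "f y * kpow Q n x y \<le> l ^ Suc n * f x"
proof -
  have "f y * Q x y \<le> l * f x" for x
    using kapp_ge_point[of Q x y f] right[of x] by (simp add: mult.commute)
  then show ?thesis
    using kpow_le[of "f y" Q y l f l n x] by (simp add: right)
qed

text \<open>Transposing puts the weight on the other side of \<open>P\<close>; conjugation by
  \<open>w\<close> moves it back. Hence the factor \<open>w\<close> on \<open>g\<close> and its
  inverse on \<open>f\<close>.\<close>

lemma positive_ground_state_transpose:
  "positive_ground_state (\<lambda>x y. P y x) C w l (\<lambda>x. w x * g x) (\<lambda>x. f x / w x)"
proof -
  interpret T: direct_step "\<lambda>x y. P y x" C by (rule direct_step_transpose)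
  have wf: "w x * (f x / w x) = f x" for x
    using w[of x] by (simp add: ennreal_times_divide mult.commute mult_divide_eq_ennreal)
  have pos: "0 < w x * g x" "w x * g x < top" "0 < f x / w x" "f x / w x < top" for x
    using w[of x] f[of x] g[of x]
    by (auto simp: ennreal_mult_less_top ennreal_zero_less_mult_iff ennreal_zero_less_divide
        ennreal_divide_eq_top_iff ennreal_mult_eq_top_iff less_le)
  show ?thesis
  proof
    fix x
    have "kapp (\<lambda>x y. P y x) (\<lambda>x. w x * g x) x = l * g x"
      unfolding left[of x, symmetric] by (simp add: kapp_def mult_ac)
    then show "kapp (\<lambda>x y. w x * P y x) (\<lambda>x. w x * g x) x = l * (w x * g x)"
      unfolding kapp_weight by (simp add: mult_ac)
    have "w x * kapp (\<lambda>y x. w x * P y x) (\<lambda>x. f x / w x) x = w x * kapp P (\<lambda>z. w z * (f z / w z)) x"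
      by (simp add: kapp_def mult_ac)
    also have "\<dots> = l * f x" using right[of x] by (simp add: wf kapp_weight)
    also have "\<dots> = w x * (l * (f x / w x))" by (simp add: wf mult.left_commute)
    finally show "kapp (\<lambda>y x. w x * P y x) (\<lambda>x. f x / w x) x = l * (f x / w x)"
      using w[of x] by (auto simp: ennreal_mult_cancel_left)
  qed (use C P w l pos vanishing in auto)
qed

lemma left_kpow_le_ground: "g x * kpow Q n x y \<le> l ^ Suc n * g y"
proof -
  have "g x * Q x y \<le> l * g y" for y
    using kapp_ge_point[of "\<lambda>y x. w x * P x y" y x g] left[of y] by (simp add: mult.commute)
  then show ?thesis
    using kpow_le[of "g x" "\<lambda>y x. w x * P x y" x l g l n y]
    by (simp add: left kpow_transpose[of Q])
qed

text \<open>The eigenvalue equation in the variable that lies in \<open>B\<close> bounds the kernel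
  by one ground state; the missing factor is a positive value at a point of \<open>B\<close>. The
  sum over \<open>B\<close> serves as a common constant.\<close>

lemma kpow_le_ground_on_finite:
  assumes "finite B"
  shows "\<exists>c<top. \<forall>n x y. x \<in> B \<or> y \<in> B \<longrightarrow> kpow Q n x y \<le> c * (l ^ Suc n * f x * g y)"
proof (intro exI conjI allI impI)
  let ?c = "\<Sum>b\<in>B. 1 / (f b * g b)"
  have fg: "0 < f b * g b" "f b * g b < top" for b
    using f[of b] g[of b] by (auto simp: ennreal_mult_less_top ennreal_zero_less_mult_iff)
  show "?c < top"
    using fg assms by (auto simp: ennreal_divide_eq_top_iff less_le)
  fix n x y assume xy: "x \<in> B \<or> y \<in> B"
  have "\<exists>b\<in>B. f b * g b * kpow Q n x y \<le> l ^ Suc n * f x * g y"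
    using xy
  proof
    assume "x \<in> B"
    then show ?thesis
      using mult_left_mono[OF left_kpow_le_ground[of x n y], of "f x"] by (auto simp: mult_ac)
  next
    assume "y \<in> B"
    then show ?thesis
      using mult_left_mono[OF kpow_le_ground[of y n x], of "g y"] by (auto simp: mult_ac)
  qed
  then obtain b where b: "b \<in> B" "f b * g b * kpow Q n x y \<le> l ^ Suc n * f x * g y" by blast
  from ennreal_le_divide[OF b(2) fg]
  have "kpow Q n x y \<le> l ^ Suc n * f x * g y / (f b * g b)" .
  also have "\<dots> = 1 / (f b * g b) * (l ^ Suc n * f x * g y)"
    by (simp add: divide_ennreal_def mult.commute)
  also have "\<dots> \<le> ?c * (l ^ Suc n * f x * g y)"
    using b assms by (intro mult_right_mono member_le_sum) auto
  finally show "kpow Q n x y \<le> ?c * (l ^ Suc n * f x * g y)" .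
qed

text \<open>Off a finite set \<open>K\<close> the weight is so small that the two-step bound lets the left-hand side
  absorb the contribution of \<open>- K\<close> to \<open>P f\<close>.\<close>

lemma eigenfunction_le:
  "\<exists>c<top. \<forall>x. f x \<le> c * (w x * P x b0)"
proof -
  \<comment> \<open>The 2 makes the contribution of \<open>- K\<close>, after the two-step bound,
    exactly half of the left-hand side.\<close>
  define e where "e = l / (2 * C)"
  define K where "K = {z. e < w z}"
  define a where "a x = kapp P (\<lambda>z. indicator K z * f z) x" for x
  have C2: "0 < 2 * C" "2 * C < top"
    using C by (auto simp: ennreal_mult_less_top ennreal_zero_less_mult_iff intro: less_le_trans[of 0 1])
  have "0 < e" using l C2 by (simp add: e_def ennreal_zero_less_divide)
  then have "finite K" unfolding K_def by (rule vanishing)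
  have e: "2 * (e * C) = l"
    using C2 by (metis e_def ennreal_times_divide less_irrefl mult.assoc mult.commute mult_divide_eq_ennreal)
  have wP: "w x * kapp P f x = l * f x" for x using right[of x] by (simp add: kapp_weight)
  have fin: "kapp P f x < top" for x
  proof -
    have "w x * kapp P f x < top" unfolding wP using l f by (simp add: ennreal_mult_less_top)
    then show ?thesis using w[of x] by (auto simp: ennreal_mult_less_top)
  qed
  have absorb: "kapp P f x \<le> 2 * a x" for x
  proof -
    have "l * kapp P f x = kapp P (\<lambda>z. w z * kapp P f z) x"
      by (simp add: wP kapp_cmult)
    also have "\<dots> \<le> kapp P (\<lambda>z. l * (indicator K z * f z) + e * kapp P f z) x"
    proof (rule kapp_mono)
      fix z
      show "w z * kapp P f z \<le> l * (indicator K z * f z) + e * kapp P f z"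
      proof (cases "z \<in> K")
        case True
        then show ?thesis by (simp add: wP)
      next
        case False
        then show ?thesis by (auto simp: K_def intro: mult_right_mono)
      qed
    qed
    also have "\<dots> \<le> l * a x + e * (C * kapp P f x)"
      unfolding kapp_add kapp_cmult a_def by (intro add_mono mult_left_mono kapp_two_step) auto
    \<comment> \<open>Doubling turns the term with \<open>e * C\<close> into
      \<open>l * kapp P f x\<close>, which can be cancelled because \<open>fin\<close> shows it
      finite.\<close>
    finally have "2 * (l * kapp P f x) \<le> 2 * (l * a x + e * (C * kapp P f x))"
      by (rule mult_left_mono) simp
    also have "\<dots> = l * (2 * a x) + l * kapp P f x"
      unfolding e[symmetric] by (simp add: distrib_left mult_ac)
    finally have "l * kapp P f x \<le> l * (2 * a x)"
      using fin[of x] l by (auto simp: mult_2 ennreal_add_left_cancel_le add.commute ennreal_mult_eq_top_iff)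
    then show ?thesis using l by (simp add: ennreal_mult_le_mult_iff)
  qed
  \<comment> \<open>Jumping from \<open>x\<close> to \<open>z\<close> and on to \<open>b0\<close> is
    at most \<open>C\<close> times as likely as the direct jump, so \<open>P x z\<close> is at most
    \<open>C / P z b0 * P x b0\<close>.\<close>
  define b where "b = (\<Sum>z\<in>K. C / P z b0 * f z)"
  have "b < top"
    unfolding b_def using \<open>finite K\<close> C P f
    by (auto simp: less_le ennreal_mult_eq_top_iff ennreal_divide_eq_top_iff)
  have a: "a x \<le> b * P x b0" for x
  proof -
    have "a x = (\<Sum>z\<in>K. P x z * f z)"
      unfolding a_def kapp_def using \<open>finite K\<close>
      by (subst nn_integral_count_space'[where A = K]) (auto intro!: sum.cong)
    also have "\<dots> \<le> (\<Sum>z\<in>K. C / P z b0 * f z * P x b0)"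
    proof (rule sum_mono)
      fix z
      have "P z b0 * P x z \<le> C * P x b0"
        using kapp_ge_point[of P x z "\<lambda>z. P z b0"] two_step[of b0 x] by (simp add: mult.commute)
      then have "P x z \<le> C * P x b0 / P z b0"
        by (rule ennreal_le_divide[OF _ P])
      then have "P x z * f z \<le> C * P x b0 / P z b0 * f z" by (rule mult_right_mono) simp
      then show "P x z * f z \<le> C / P z b0 * f z * P x b0"
        by (simp add: divide_ennreal_def mult_ac)
    qed
    finally show ?thesis by (simp add: b_def sum_distrib_right)
  qed
  have "f x \<le> 2 * b / l * (w x * P x b0)" for x
  proof -
    have "l * f x \<le> w x * (2 * (b * P x b0))"
      unfolding wP[symmetric] using order_trans[OF absorb mult_left_mono[OF a]]
      by (intro mult_left_mono) auto
    then have "f x \<le> w x * (2 * (b * P x b0)) / l"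
      by (rule ennreal_le_divide[OF _ l])
    then show ?thesis by (simp add: divide_ennreal_def mult_ac)
  qed
  moreover have "2 * b / l < top"
    using \<open>b < top\<close> l by (auto simp: less_le ennreal_mult_eq_top_iff ennreal_divide_eq_top_iff)
  ultimately show ?thesis by blast
qed

text \<open>Through a reference site \<open>b0\<close>, \<open>f\<close> is controlled by jumps into
  \<open>b0\<close> and \<open>g\<close> by jumps out of it; the two-step bound merges both into
  \<open>P x y\<close>. This settles one step, and \<open>kpow_ge\<close> propagates it.\<close>

lemma kpow_ge_ground:
  "\<exists>c<top. \<forall>n x y. l ^ Suc n * f x * g y \<le> c * kpow Q n x y"
proof -
  fix b0 :: 'a
  interpret T: positive_ground_state "\<lambda>x y. P y x" C w l "\<lambda>x. w x * g x" "\<lambda>x. f x / w x"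
    by (rule positive_ground_state_transpose)
  obtain c where c: "c < top" "\<And>x. f x \<le> c * (w x * P x b0)"
    using eigenfunction_le by blast
  obtain d where d: "d < top" "\<And>y. w y * g y \<le> d * (w y * P b0 y)"
    using T.eigenfunction_le by blast
  have g_le: "g y \<le> d * P b0 y" for y
    using d(2)[of y] w[of y] by (simp add: mult.left_commute[of d] ennreal_mult_le_mult_iff)
  define k where "k = c * d * C * l"
  have k: "k < top" using c d C l by (simp add: k_def ennreal_mult_less_top)
  have base: "l * f x * g y \<le> k * Q x y" for x y
  proof -
    have "l * f x * g y \<le> l * (c * (w x * P x b0)) * (d * P b0 y)"
      by (intro mult_mono c g_le order_refl) auto
    also have "\<dots> = l * c * d * w x * (P x b0 * P b0 y)" by (simp add: mult_ac)
    also have "\<dots> \<le> l * c * d * w x * (C * P x y)"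
      using order_trans[OF kapp_ge_point[of P x b0 "\<lambda>z. P z y"] two_step]
      by (rule mult_left_mono) simp
    finally show ?thesis by (simp add: k_def mult_ac)
  qed
  have "l ^ Suc n * f x * g y \<le> k * kpow Q n x y" for n x y
    using kpow_ge[of "l * g y" f k Q y l n x] base[of _ y] by (simp add: right mult_ac)
  then show ?thesis using k by blast
qed

text \<open>Starting points in \<open>B\<close> are covered by the previous bound. The constant
  \<open>D\<close> of \<open>kpow_le_majorant\<close> is taken as \<open>c * l * g y\<close>, which
  supplies the extra power of \<open>l\<close>.\<close>

lemma kpow_le_ground_majorant:
  assumes "finite B"
  shows "\<exists>c<top. \<forall>n x y. x \<notin> B \<longrightarrow>
    kpow Q n x y \<le> c * (l ^ Suc n * f x * g y) + (3 * C) ^ n * majorant w (- B) n x y"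
proof -
  obtain c where c: "c < top" "\<And>n x y. x \<in> B \<or> y \<in> B \<Longrightarrow> kpow Q n x y \<le> c * (l ^ Suc n * f x * g y)"
    using kpow_le_ground_on_finite[OF assms] by blast
  have *: "kpow Q n x y \<le> c * l * g y * l ^ n * f x + (3 * C) ^ n * (indicator (- B) x * majorant w (- B) n x y)"
    for n x y
    by (rule kpow_le_majorant) (use C c(2)[of _ y] in \<open>auto simp: right mult_ac\<close>)
  have "kpow Q n x y \<le> c * (l ^ Suc n * f x * g y) + (3 * C) ^ n * majorant w (- B) n x y"
    if "x \<notin> B" for n x y
    using *[of n x y] that by (simp add: mult_ac)
  then show ?thesis using c(1) by blast
qed

end

section \<open>Passage to real kernels\<close>

text \<open>From \<open>h \<le> 1 + h^2\<close>: the constant is summed against \<open>K\<close>,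
  the square against \<open>p * \<mu>\<close>. It ensures that the sums in the eigenvalue equations
  are genuine.\<close>

lemma summable_on_mult_l2:
  fixes K h :: "'a \<Rightarrow> real"
  assumes K: "\<And>y. 0 \<le> K y" "K summable_on UNIV" "\<And>y. K y \<le> p * \<mu> y"
    and h: "h \<in> l2 \<mu>" "\<And>y. 0 \<le> h y"
  shows "(\<lambda>y. K y * h y) summable_on UNIV"
proof (rule summable_on_comparison_test)
  show "(\<lambda>y. K y + p * ((norm (h y))\<^sup>2 * \<mu> y)) summable_on UNIV"
    using h(1) by (intro summable_on_add K summable_on_cmult_right) (simp add: l2_def)
  fix y
  have "h y \<le> 1 + (h y)\<^sup>2"
    using sum_squares_ge_zero[of "h y - 1" "h y"] h(2)[of y]
    by (simp add: power2_eq_square algebra_simps)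
  then have "K y * h y \<le> K y + K y * (h y)\<^sup>2"
    using mult_left_mono[OF _ K(1)] by (fastforce simp: algebra_simps)
  also have "K y * (h y)\<^sup>2 \<le> p * \<mu> y * (h y)\<^sup>2"
    using K(3) by (intro mult_right_mono) auto
  finally show "K y * h y \<le> K y + p * ((norm (h y))\<^sup>2 * \<mu> y)"
    by (simp add: mult_ac)
qed (use K h in auto)

lemma kapp_ennreal:
  assumes "\<And>z. 0 \<le> f z" "\<And>z. 0 \<le> K x z" "(\<lambda>z. K x z * f z) summable_on UNIV"
  shows "kapp (\<lambda>x z. ennreal (K x z)) (\<lambda>z. ennreal (f z)) x = ennreal (\<Sum>\<^sub>\<infinity>z. K x z * f z)"
  using assms by (simp add: kapp_def ennreal_infsum ennreal_mult)

text \<open>The factor \<open>\<mu> y\<close> passes from densities to counting measure. Finiteness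
  keeps \<open>infsum\<close> from its default value, and nonnegativity is carried along because
  \<open>ennreal\<close> truncates negative numbers.\<close>

lemma kpow_eq_fk_kernel:
  assumes P: "\<And>x y. 0 \<le> P x y" and \<mu>: "\<And>x. 0 < \<mu> x" and V: "\<And>x. 0 < V x"
    and finite: "\<And>n x y. kpow (\<lambda>x y. ennreal (1 / V x) * ennreal (P x y)) n x y < top"
  shows "0 \<le> fk_kernel \<mu> P V (Suc n) x y \<and>
    kpow (\<lambda>x y. ennreal (1 / V x) * ennreal (P x y)) n x y = ennreal (fk_kernel \<mu> P V (Suc n) x y * \<mu> y)"
proof (induction n arbitrary: x y)
  case 0
  have "0 < \<mu> y" "0 < V x" "0 \<le> P x y" using P \<mu> V by auto
  then show ?case by (simp add: dens_def ennreal_mult[symmetric] mult.commute)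
next
  case (Suc n)
  define t where "t z = fk_kernel \<mu> P V (Suc n) x z * fk_kernel \<mu> P V (Suc 0) z y * \<mu> z" for z
  have fk1: "0 \<le> fk_kernel \<mu> P V (Suc 0) z y" for z
    using P[of z y] \<mu>[of y] V[of z] by (simp add: dens_def)
  have t: "0 \<le> t z" for z
    using Suc[of x z] fk1[of z] \<mu>[of z] by (simp add: t_def del: fk_kernel.simps)
  have "kpow (\<lambda>x y. ennreal (1 / V x) * ennreal (P x y)) (Suc n) x y
    = (\<integral>\<^sup>+z. ennreal (\<mu> y) * ennreal (t z) \<partial>count_space UNIV)"
    unfolding kpow.simps kapp_def
  proof (rule nn_integral_cong)
    fix z
    have "ennreal (1 / V z) * ennreal (P z y) = ennreal (fk_kernel \<mu> P V (Suc 0) z y * \<mu> y)"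
      using P[of z y] \<mu>[of y] V[of z] by (simp add: dens_def ennreal_mult[symmetric] mult.commute)
    then show "kpow (\<lambda>x y. ennreal (1 / V x) * ennreal (P x y)) n x z * (ennreal (1 / V z) * ennreal (P z y))
      = ennreal (\<mu> y) * ennreal (t z)"
      using Suc[of x z] fk1[of z] \<mu>[of z] \<mu>[of y]
      by (simp add: ennreal_mult[symmetric] t_def mult_ac del: fk_kernel.simps)
  qed
  then have eq: "kpow (\<lambda>x y. ennreal (1 / V x) * ennreal (P x y)) (Suc n) x y
    = ennreal (\<mu> y) * (\<integral>\<^sup>+z. ennreal (t z) \<partial>count_space UNIV)"
    by (simp add: nn_integral_cmult)
  then have "(\<integral>\<^sup>+z. ennreal (t z) \<partial>count_space UNIV) < top"
    using finite[of "Suc n" x y] \<mu>[of y] by (auto simp: ennreal_mult_less_top)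
  then have "ennreal (\<Sum>\<^sub>\<infinity>z. t z) = (\<integral>\<^sup>+z. ennreal (t z) \<partial>count_space UNIV)"
    using t by (intro ennreal_infsum_if_nn_integral_finite)
  moreover have "0 \<le> (\<Sum>\<^sub>\<infinity>z. t z)" using t by (intro infsum_nonneg) auto
  moreover have "fk_kernel \<mu> P V (Suc (Suc n)) x y = (\<Sum>\<^sub>\<infinity>z. t z)"
    by (simp add: t_def)
  ultimately show ?case
    using eq \<mu>[of y] by (simp add: ennreal_mult mult.commute less_imp_le del: kpow.simps fk_kernel.simps)
qed

text \<open>In \<open>F_term\<close> the factor \<open>\<mu> z\<close> cancels the density of the
  first jump, leaving only \<open>1 / \<mu> y\<close>. The lower bound \<open>\<delta>\<close> gives
  summability.\<close>

lemma kapp_eq_F_term: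
  fixes x y :: 'a and A :: "nat \<Rightarrow> 'a set" and B :: "'a set"
  assumes P: "subprob_kernel P" and \<mu>: "\<And>x. 0 < \<mu> x" and V: "0 < \<delta>" "\<And>x. \<delta> \<le> V x"
  defines "S \<equiv> - B \<inter> A (first_appearance A x) \<inter> A (first_appearance A y)"
  shows "0 \<le> F_term \<mu> P V A B (Suc n) x y"
    and "ennreal (1 / V x) * kapp (\<lambda>x y. ennreal (P x y))
        (\<lambda>z. indicator S z * ennreal (1 / V z) ^ n * ennreal (P z y)) x
      = ennreal (F_term \<mu> P V A B (Suc n) x y * \<mu> y)"
proof -
  define t where "t z = indicator S z * (1 / V z) ^ n * P z y" for z
  have Vpos: "0 < V z" for z using V(1) V(2)[of z] by linarith
  have P01: "0 \<le> P z u" "P z u \<le> 1" for z u using P by (auto simp: subprob_kernel_def)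
  have t: "0 \<le> t z" "t z \<le> (1 / \<delta>) ^ n" for z
  proof -
    show "0 \<le> t z" using P01 Vpos[of z] by (simp add: t_def)
    have "t z \<le> 1 * (1 / \<delta>) ^ n * 1"
      unfolding t_def using P01 Vpos V
      by (intro mult_mono power_mono frac_le) (auto simp: indicator_def less_imp_le)
    then show "t z \<le> (1 / \<delta>) ^ n" by simp
  qed
  have sum: "(\<lambda>z. P x z * t z) summable_on UNIV"
  proof (rule summable_on_comparison_test)
    show "(\<lambda>z. P x z * (1 / \<delta>) ^ n) summable_on UNIV"
      using P by (intro summable_on_cmult_left) (auto simp: subprob_kernel_def)
  qed (use P01 t in \<open>auto intro: mult_left_mono\<close>)
  have "(\<Sum>\<^sub>\<infinity>z\<in>S. dens \<mu> P x z * dens \<mu> P z y * (1 / V z ^ n) * \<mu> z)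
      = (\<Sum>\<^sub>\<infinity>z. P x z * t z * (1 / \<mu> y))"
    by (rule infsum_cong_neutral) (use \<mu> in \<open>auto simp: t_def dens_def field_simps less_imp_neq[THEN not_sym]\<close>)
  also have "\<dots> = (\<Sum>\<^sub>\<infinity>z. P x z * t z) * (1 / \<mu> y)" by (rule infsum_cmult_left')
  finally have F: "F_term \<mu> P V A B (Suc n) x y = 1 / V x * ((\<Sum>\<^sub>\<infinity>z. P x z * t z) * (1 / \<mu> y))"
    by (simp add: F_term_def S_def)
  have nonneg: "0 \<le> (\<Sum>\<^sub>\<infinity>z. P x z * t z)" using P01 t by (intro infsum_nonneg) auto
  then show "0 \<le> F_term \<mu> P V A B (Suc n) x y"
    unfolding F using Vpos[of x] \<mu>[of y] by simp
  have "(\<lambda>z. indicator S z * ennreal (1 / V z) ^ n * ennreal (P z y)) = (\<lambda>z. ennreal (t z))"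
  proof
    fix z
    show "indicator S z * ennreal (1 / V z) ^ n * ennreal (P z y) = ennreal (t z)"
      using Vpos[of z] P01[of z y]
      by (auto simp: t_def indicator_def ennreal_mult ennreal_power less_imp_le)
  qed
  then have "kapp (\<lambda>x y. ennreal (P x y)) (\<lambda>z. indicator S z * ennreal (1 / V z) ^ n * ennreal (P z y)) x
    = ennreal (\<Sum>\<^sub>\<infinity>z. P x z * t z)"
    using kapp_ennreal[of t P x] t P01 sum by simp
  then show "ennreal (1 / V x) * kapp (\<lambda>x y. ennreal (P x y))
        (\<lambda>z. indicator S z * ennreal (1 / V z) ^ n * ennreal (P z y)) x
      = ennreal (F_term \<mu> P V A B (Suc n) x y * \<mu> y)"
    unfolding F using Vpos[of x] \<mu>[of y] nonneg by (simp add: ennreal_mult[symmetric])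
qed

lemma direct_step_ennreal:
  assumes P: "subprob_kernel P" and C: "0 \<le> C" "\<And>x y. two_step P x y \<le> C * P x y"
  shows "direct_step (\<lambda>x y. ennreal (P x y)) (ennreal C)"
proof
  fix x y
  have P01: "0 \<le> P z u" "P z u \<le> 1" for z u using P by (auto simp: subprob_kernel_def)
  have "(\<lambda>z. P x z * P z y) summable_on UNIV"
    by (rule summable_on_comparison_test[of "P x"])
      (use P P01 in \<open>auto simp: subprob_kernel_def intro: mult_left_le\<close>)
  then have "kapp (\<lambda>x y. ennreal (P x y)) (\<lambda>z. ennreal (P z y)) x = ennreal (two_step P x y)"
    using kapp_ennreal[of "\<lambda>z. P z y" P x] P01 by (simp add: two_step_def)
  also have "\<dots> \<le> ennreal (C * P x y)" by (intro ennreal_leI C)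
  finally show "kapp (\<lambda>x y. ennreal (P x y)) (\<lambda>z. ennreal (P z y)) x \<le> ennreal C * ennreal (P x y)"
    using C P01 by (simp add: ennreal_mult)
qed

lemma confining_finite_superlevel:
  assumes "confining V" "\<And>x. 0 < V x" "0 < e"
  shows "finite {z. e < ennreal (1 / V z)}"
proof (cases e)
  case (real r)
  then have "0 < r" using assms(3) by auto
  then obtain M :: nat where M: "0 < M" "inverse (real M) < r"
    using ex_inverse_of_nat_less by blast
  then obtain B where B: "finite B" "\<forall>x\<in>- B. real M \<le> V x"
    using assms(1) unfolding confining_def by (metis Suc_leI One_nat_def)
  have "{z. e < ennreal (1 / V z)} \<subseteq> B"
  proof
    fix z assume "z \<in> {z. e < ennreal (1 / V z)}"
    then have r: "r < 1 / V z" using real assms(2)[of z] by (simp add: ennreal_less_iff)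
    show "z \<in> B"
    proof (rule ccontr)
      assume "z \<notin> B"
      then have "1 / V z \<le> inverse (real M)"
        using B M by (auto simp: inverse_eq_divide intro!: frac_le)
      then show False using r M by linarith
    qed
  qed
  then show ?thesis using B(1) by (rule finite_subset)
next
  case top
  then show ?thesis by simp
qed

lemma first_appearance_mem:
  assumes "exhausting A"
  shows "first_appearance A x \<ge> 1 \<and> x \<in> A (first_appearance A x)"
proof -
  have "\<exists>n. n \<ge> 1 \<and> x \<in> A n" using assms unfolding exhausting_def by fastforce
  then show ?thesis unfolding first_appearance_def by (rule LeastI_ex)
qed

lemma mem_exhausting_iff:
  assumes "exhausting A" "1 \<le> n"
  shows "x \<in> A n \<longleftrightarrow> first_appearance A x \<le> n"
proof
  assume "x \<in> A n"
  then show "first_appearance A x \<le> n"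
    unfolding first_appearance_def using assms(2) by (intro Least_le) simp
next
  assume "first_appearance A x \<le> n"
  then have "A (first_appearance A x) \<subseteq> A n"
  proof (induction n rule: dec_induct)
    case (step m)
    have "1 \<le> m" using first_appearance_mem[OF assms(1), of x] step by simp
    then show ?case using step assms(1) by (auto simp: exhausting_def)
  qed simp
  then show "x \<in> A n" using first_appearance_mem[OF assms(1), of x] by blast
qed

theorem theorem3p4:
  fixes P Phat :: "'a \<Rightarrow> 'a \<Rightarrow> real"
    and \<mu> V \<phi> \<phi>hat :: "'a \<Rightarrow> real"
    and Cstar lam0 :: real
    and A :: "nat \<Rightarrow> 'a set"
    and B :: "'a set"
  assumes X_countable: "countable (UNIV :: 'a set)"
    and X_infinite: "infinite (UNIV :: 'a set)"
    and P_kernel: "subprob_kernel P"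
    and Phat_kernel: "subprob_kernel Phat"
    and \<mu>_pos: "\<And>x. \<mu> x > 0"
    and duality: "\<And>x y. \<mu> x * P x y = \<mu> y * Phat y x"
    and V_potential: "potential V"
    and P_pos: "\<And>x y. P x y > 0"
    and Cstar_ge: "Cstar \<ge> 1"
    and two_step_le: "\<And>x y. two_step P x y \<le> Cstar * P x y"
    and diag: "inf_diag P > 0"
    and dens_bounded: "bdd_above (range (\<lambda>(x, y). P x y / \<mu> y))"
    and V_confining: "confining V"
    and lam0_def: "lam0 = l2_spectral_radius \<mu> (feynman_kac P V)"
    and ground: "ground_state \<mu> (feynman_kac P V) lam0 \<phi>"
    and ground_dual: "ground_state \<mu> (feynman_kac_dual Phat V) lam0 \<phi>hat"
    and A_exhausting: "exhausting A"
    and V_increasing: "increasing_wrt A V"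
    and B_finite: "finite B"
  shows "\<exists>C>0.
      (\<forall>n\<ge>1. \<forall>x y. x \<in> B \<or> y \<in> B \<longrightarrow>
         inverse C * lam0 ^ n * \<phi> x * \<phi>hat y \<le> fk_kernel \<mu> P V n x y \<and>
         fk_kernel \<mu> P V n x y \<le> C * lam0 ^ n * \<phi> x * \<phi>hat y) \<and>
      (\<forall>n\<ge>1. \<forall>x y. x \<in> - B \<and> y \<in> - B \<longrightarrow>
         inverse C * (lam0 ^ n * \<phi> x * \<phi>hat y
             + (min (inverse Cstar) (inf_diag P)) ^ n * F_term \<mu> P V A B n x y)
           \<le> fk_kernel \<mu> P V n x y \<and>
         fk_kernel \<mu> P V n x y
           \<le> C * (lam0 ^ n * \<phi> x * \<phi>hat y
             + (max (3 * Cstar) (inverse (inf_diag P))) ^ n * F_term \<mu> P V A B n x y)) \<and>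
      (\<forall>n\<ge>1. \<forall>x y. inverse C * lam0 ^ n * \<phi> x * \<phi>hat y \<le> fk_kernel \<mu> P V n x y)"
proof -

  \<comment> \<open>Uniform bounds and the eigenvalue equations\<close>
  obtain \<delta> where \<delta>: "0 < \<delta>" "\<And>x. \<delta> \<le> V x"
  proof
    show "0 < (INF x. V x)" using V_potential by (simp add: potential_def)
    show "(INF x. V x) \<le> V x" for x
      using V_potential by (intro cINF_lower bdd_belowI2[where m = 0]) (auto simp: potential_def less_imp_le)
  qed
  have V: "0 < V x" for x using \<delta>(1) \<delta>(2)[of x] by linarith
  have P01: "0 \<le> P x y" "P x y \<le> 1" for x y using P_kernel by (auto simp: subprob_kernel_def)
  define cd where "cd = inf_diag P"
  have cd: "0 < cd" "cd \<le> P z z" "cd \<le> 1" for z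
  proof -
    show "0 < cd" using diag by (simp add: cd_def)
    show le: "cd \<le> P z z" for z
      unfolding cd_def inf_diag_def using P01 by (intro cINF_lower bdd_belowI2[where m = 0]) auto
    show "cd \<le> 1" using le[of z] P01(2)[of z z] by linarith
  qed
  obtain p where p: "\<And>x y. P x y \<le> p * \<mu> y"
  proof -
    obtain p where "\<forall>t\<in>range (\<lambda>(x, y). P x y / \<mu> y). t \<le> p"
      using dens_bounded by (auto simp: bdd_above_def)
    then have *: "P x y / \<mu> y \<le> p" for x y by fastforce
    have "P x y \<le> p * \<mu> y" for x y using *[of x y] \<mu>_pos[of y] by (simp add: pos_divide_le_eq)
    then show thesis by (rule that)
  qed
  have Phat_eq: "Phat y x = \<mu> x * P x y / \<mu> y" for x y
    using duality[of x y] \<mu>_pos[of y] by (simp add: field_simps)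
  have Phat_le: "Phat y x \<le> p * \<mu> x" for x y
  proof -
    have "P x y / \<mu> y \<le> p" using p[of x y] \<mu>_pos[of y] by (simp add: pos_divide_le_eq)
    then show ?thesis
      using mult_left_mono[of "P x y / \<mu> y" p "\<mu> x"] \<mu>_pos[of x] by (simp add: Phat_eq mult.commute)
  qed
  have \<phi>: "0 < \<phi> x" "\<phi> \<in> l2 \<mu>" "(\<Sum>\<^sub>\<infinity>y. P x y * \<phi> y) = lam0 * \<phi> x * V x" for x
  proof -
    show "0 < \<phi> x" "\<phi> \<in> l2 \<mu>" using ground by (auto simp: ground_state_def)
    have "(\<Sum>\<^sub>\<infinity>y. P x y * \<phi> y) / V x = lam0 * \<phi> x"
      using ground by (simp add: ground_state_def feynman_kac_def)
    then show "(\<Sum>\<^sub>\<infinity>y. P x y * \<phi> y) = lam0 * \<phi> x * V x"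
      using V[of x] by (auto simp: divide_eq_eq)
  qed
  have \<phi>hat: "0 < \<phi>hat x" "\<phi>hat \<in> l2 \<mu>"
    "(\<Sum>\<^sub>\<infinity>y. Phat x y * (1 / V y) * \<phi>hat y) = lam0 * \<phi>hat x" for x
    using ground_dual by (auto simp: ground_state_def feynman_kac_dual_def)

  \<comment> \<open>Ground states as right and left eigenvectors over \<open>ennreal\<close>\<close>
  define PE where "PE x y = ennreal (P x y)" for x y
  define w where "w x = ennreal (1 / V x)" for x
  define f where "f x = ennreal (\<phi> x)" for x
  define g where "g x = ennreal (\<phi>hat x * \<mu> x)" for x
  interpret direct_step PE "ennreal Cstar"
    unfolding PE_def using P_kernel Cstar_ge two_step_le by (intro direct_step_ennreal) auto
  have right: "kapp (\<lambda>x y. w x * PE x y) f x = ennreal lam0 * f x" for x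
  proof -
    have "(\<lambda>y. P x y * \<phi> y) summable_on UNIV"
      by (rule summable_on_mult_l2[where \<mu> = \<mu> and p = p])
        (use P_kernel P01 p \<phi> in \<open>auto simp: subprob_kernel_def less_imp_le\<close>)
    then have "kapp PE f x = ennreal (lam0 * \<phi> x * V x)"
      unfolding PE_def f_def using \<phi> P01 by (subst kapp_ennreal) (auto simp: less_imp_le)
    then have "w x * kapp PE f x = ennreal (lam0 * \<phi> x)"
      unfolding w_def using V[of x] by (simp add: ennreal_mult'[symmetric])
    then show ?thesis
      unfolding kapp_weight f_def using \<phi>(1)[of x] by (simp add: ennreal_mult'')
  qed
  have left: "kapp (\<lambda>y x. w x * PE x y) g y = ennreal lam0 * g y" for y
  proof -
    have Phat0: "0 \<le> Phat x y" for x y using Phat_kernel by (auto simp: subprob_kernel_def)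
    have nonneg: "0 \<le> Phat y x * (1 / V x) * \<phi>hat x" for x
      using Phat0 V[of x] \<phi>hat(1)[of x] by simp
    have "(\<lambda>x. Phat y x * \<phi>hat x) summable_on UNIV"
      by (rule summable_on_mult_l2[where \<mu> = \<mu> and p = p])
        (use Phat_kernel Phat0 Phat_le \<phi>hat in \<open>auto simp: subprob_kernel_def less_imp_le\<close>)
    then have "(\<lambda>x. Phat y x * \<phi>hat x * (1 / \<delta>)) summable_on UNIV"
      by (rule summable_on_cmult_left)
    then have sum: "(\<lambda>x. Phat y x * (1 / V x) * \<phi>hat x) summable_on UNIV"
    proof (rule summable_on_comparison_test)
      fix x
      have "Phat y x * \<phi>hat x * (1 / V x) \<le> Phat y x * \<phi>hat x * (1 / \<delta>)"
        using \<delta> V[of x] Phat0 \<phi>hat(1)[of x] by (intro mult_left_mono frac_le) (auto simp: less_imp_le)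
      then show "Phat y x * (1 / V x) * \<phi>hat x \<le> Phat y x * \<phi>hat x * (1 / \<delta>)" by (simp add: mult_ac)
    qed (rule nonneg)
    \<comment> \<open>Duality exchanges \<open>\<mu> x * P x y\<close> for
      \<open>\<mu> y * Phat y x\<close>; this is why \<open>g\<close> carries the factor
      \<open>\<mu>\<close>.\<close>
    have "w x * PE x y * g x = ennreal (\<mu> y) * ennreal (Phat y x * (1 / V x) * \<phi>hat x)" for x
    proof -
      have "1 / V x * P x y * (\<phi>hat x * \<mu> x) = \<mu> y * (Phat y x * (1 / V x) * \<phi>hat x)"
        using \<mu>_pos[of y] by (simp add: Phat_eq)
      then show ?thesis
        unfolding w_def PE_def g_def using V[of x] P01[of x y] \<mu>_pos[of x] \<mu>_pos[of y] \<phi>hat(1)[of x] nonneg[of x]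
        by (simp add: ennreal_mult[symmetric] del: times_divide_eq_right times_divide_eq_left)
    qed
    then have "kapp (\<lambda>y x. w x * PE x y) g y = ennreal (\<mu> y) * (\<integral>\<^sup>+x. ennreal (Phat y x * (1 / V x) * \<phi>hat x) \<partial>count_space UNIV)"
      by (simp add: kapp_def nn_integral_cmult)
    also have "\<dots> = ennreal (\<mu> y) * ennreal (lam0 * \<phi>hat y)"
      unfolding ennreal_infsum[OF nonneg sum, symmetric] \<phi>hat(3) ..
    also have "\<dots> = ennreal lam0 * g y"
      unfolding g_def using \<mu>_pos[of y] \<phi>hat(1)[of y] by (simp add: ennreal_mult'' mult_ac)
    finally show ?thesis .
  qed
  \<comment> \<open>So far \<open>ennreal lam0\<close> might be 0 by truncation; a single diagonal
    term of the eigenvalue equation excludes this.\<close>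
  have lam0: "0 < lam0"
  proof -
    fix x
    have "0 < w x * PE x x * f x"
      using V[of x] P_pos[of x x] \<phi>(1)[of x] by (simp add: w_def PE_def f_def ennreal_zero_less_mult_iff)
    also have "\<dots> \<le> ennreal lam0 * f x"
      unfolding right[symmetric] by (rule kapp_ge_point)
    finally show ?thesis by (auto simp: ennreal_zero_less_mult_iff)
  qed
  interpret positive_ground_state PE "ennreal Cstar" w "ennreal lam0" f g
  proof
    show "finite {z. e < w z}" if "0 < e" for e
      unfolding w_def using confining_finite_superlevel[OF V_confining V that] .
  qed (use Cstar_ge P_pos V \<phi> \<phi>hat \<mu>_pos lam0 right left in
      \<open>auto simp: PE_def w_def f_def g_def ennreal_1[symmetric] simp del: ennreal_1\<close>)

  \<comment> \<open>The kernel, the ground state product and \<open>F\<close> as real numbers, with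
    index shifted by one\<close>
  define u where "u n x y = fk_kernel \<mu> P V (Suc n) x y" for n x y
  define G where "G n x y = lam0 ^ Suc n * \<phi> x * \<phi>hat y" for n x y
  define F where "F n x y = F_term \<mu> P V A B (Suc n) x y" for n x y
  \<comment> \<open>Supplies the finiteness required by \<open>kpow_eq_fk_kernel\<close>.\<close>
  have kpow_fin: "kpow Q n x y < top" for n x y
  proof -
    have "f y * kpow Q n x y \<le> ennreal lam0 ^ Suc n * f x"
      by (rule kpow_le_ground)
    also have "\<dots> < top" using lam0 by (simp add: f_def ennreal_mult_less_top ennreal_power)
    finally show ?thesis using f(1)[of y] by (auto simp: ennreal_mult_less_top)
  qed
  have u: "0 \<le> u n x y" "kpow Q n x y = ennreal (u n x y * \<mu> y)" for n x y
    using kpow_eq_fk_kernel[of P \<mu> V n x y] P01 \<mu>_pos V kpow_fin by (auto simp: u_def w_def PE_def)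
  have G: "0 \<le> G n x y" "ennreal lam0 ^ Suc n * f x * g y = ennreal (G n x y * \<mu> y)" for n x y
    using lam0 \<phi>(1)[of x] \<phi>hat(1)[of y] \<mu>_pos[of y]
    by (auto simp: G_def f_def g_def ennreal_mult[symmetric] ennreal_power mult_ac simp del: power_Suc)
  define S where "S x y = - B \<inter> A (first_appearance A x) \<inter> A (first_appearance A y)" for x y
  have F: "0 \<le> F n x y" "w x * loops w (S x y) n x y = ennreal (F n x y * \<mu> y)" for n x y
    using kapp_eq_F_term[OF P_kernel \<mu>_pos \<delta>, where A = A and B = B and x = x and y = y and n = n]
    unfolding F_def S_def loops_def w_def PE_def by auto
  have real_bound: "a \<le> b" if "ennreal (a * \<mu> y) \<le> ennreal (b * \<mu> y)" "0 \<le> b" for a b y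
    using that \<mu>_pos[of y] by (auto simp: ennreal_le_iff)

  have em: "ennreal a * ennreal (b * \<mu> y) = ennreal (a * b * \<mu> y)" if "0 \<le> a" for a b y
    using that by (simp add: ennreal_mult' mult.assoc)
  have cdP: "ennreal cd \<le> PE z z" for z
    unfolding PE_def using cd(2) by (rule ennreal_leI)

  \<comment> \<open>Comparison with the ground states\<close>
  obtain c where c: "0 \<le> c" "\<And>n x y. G n x y \<le> c * u n x y"
  proof -
    obtain c where "c < top" "\<And>n x y. ennreal lam0 ^ Suc n * f x * g y \<le> c * kpow Q n x y"
      using kpow_ge_ground by blast
    then obtain r where r: "0 \<le> r" "\<And>n x y. ennreal lam0 ^ Suc n * f x * g y \<le> ennreal r * kpow Q n x y"
      by (cases c) auto
    have "G n x y \<le> r * u n x y" for n x y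
      using r(2)[of n x y] unfolding G(2) u(2) em[OF r(1)]
      by (rule real_bound) (use u(1) r(1) in simp)
    with \<open>0 \<le> r\<close> show thesis by (rule that)
  qed
  obtain d where d: "0 \<le> d" "\<And>n x y. x \<in> B \<or> y \<in> B \<Longrightarrow> u n x y \<le> d * G n x y"
  proof -
    obtain c where "c < top" "\<And>n x y. x \<in> B \<or> y \<in> B \<Longrightarrow> kpow Q n x y \<le> c * (ennreal lam0 ^ Suc n * f x * g y)"
      using kpow_le_ground_on_finite[OF B_finite] by blast
    then obtain r where r: "0 \<le> r"
      "\<And>n x y. x \<in> B \<or> y \<in> B \<Longrightarrow> kpow Q n x y \<le> ennreal r * (ennreal lam0 ^ Suc n * f x * g y)"
      by (cases c) auto
    have "u n x y \<le> r * G n x y" if "x \<in> B \<or> y \<in> B" for n x y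
      using r(2)[OF that, of n] unfolding G(2) u(2) em[OF r(1)]
      by (rule real_bound) (use G(1) r(1) in simp)
    with \<open>0 \<le> r\<close> show thesis by (rule that)
  qed

  \<comment> \<open>Lower bound by \<open>F\<close>\<close>
  define Cup where "Cup = max (3 * Cstar) (inverse cd)"
  define Clow where "Clow = min (inverse Cstar) cd"
  have F_le: "Clow ^ Suc n * F n x y \<le> u n x y" for n x y
  proof (cases n)
    case 0
    have "ennreal (F 0 x y * \<mu> y) \<le> ennreal (Cstar * u 0 x y * \<mu> y)"
      using loops_0_le[of w x "S x y" y] u(2)[of 0 x y] em[of Cstar "u 0 x y" y] Cstar_ge
      by (simp add: F(2))
    then have "F 0 x y \<le> Cstar * u 0 x y"
      by (rule real_bound) (use u Cstar_ge in simp)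
    then have "inverse Cstar * F 0 x y \<le> u 0 x y"
      using Cstar_ge by (simp add: field_simps)
    moreover have "Clow * F 0 x y \<le> inverse Cstar * F 0 x y"
      using F(1) by (intro mult_right_mono) (auto simp: Clow_def)
    ultimately show ?thesis using 0 by simp
  next
    case (Suc m)
    have "ennreal (cd ^ m * F n x y * \<mu> y) \<le> ennreal (u n x y * \<mu> y)"
      using loops_le_kpow[OF cdP, of m w x "S x y" y] em[of "cd ^ m" "F n x y" y] cd(1)
      by (simp add: Suc F(2) u(2) ennreal_power del: kpow.simps)
    then have "cd ^ m * F n x y \<le> u n x y" by (rule real_bound) (rule u)
    \<comment> \<open>The path bound needs only \<open>m = n - 1\<close> powers; the two surplus
      ones are harmless since \<open>cd \<le> 1\<close>.\<close>
    moreover have "Clow ^ Suc n \<le> cd ^ m"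
    proof -
      have "Clow ^ Suc n \<le> cd ^ Suc n"
        using cd(1) Cstar_ge by (intro power_mono) (auto simp: Clow_def)
      also have "\<dots> \<le> cd ^ m" using cd Suc by (intro power_decreasing) (auto simp: less_imp_le)
      finally show ?thesis .
    qed
    ultimately show ?thesis
      using mult_right_mono[of "Clow ^ Suc n" "cd ^ m" "F n x y"] F(1)[of n x y] by linarith
  qed

  \<comment> \<open>Upper bound off \<open>B\<close>\<close>
  define k where "k = (cd + Cstar + 1) / cd"
  have k: "0 \<le> k" using cd(1) Cstar_ge by (simp add: k_def)
  obtain e where e: "0 \<le> e"
    "\<And>n x y. x \<notin> B \<Longrightarrow> y \<notin> B \<Longrightarrow> u n x y \<le> e * G n x y + k * (Cup ^ Suc n * F n x y)"
  proof -
    obtain c where "c < top" "\<And>n x y. x \<notin> B \<Longrightarrow> kpow Q n x y \<le> c * (ennreal lam0 ^ Suc n * f x * g y)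
        + (3 * ennreal Cstar) ^ n * majorant w (- B) n x y"
      using kpow_le_ground_majorant[OF B_finite] by blast
    then obtain r where r: "0 \<le> r" "\<And>n x y. x \<notin> B \<Longrightarrow> kpow Q n x y
        \<le> ennreal r * (ennreal lam0 ^ Suc n * f x * g y) + (3 * ennreal Cstar) ^ n * majorant w (- B) n x y"
      by (cases c) auto
    have "u n x y \<le> r * G n x y + k * (Cup ^ Suc n * F n x y)" if xy: "x \<notin> B" "y \<notin> B" for n x y
    proof -
      let ?a = "first_appearance A"
      have mem: "z \<in> A (?a x) \<longleftrightarrow> ?a z \<le> ?a x" for z x
        using mem_exhausting_iff[OF A_exhausting] first_appearance_mem[OF A_exhausting] by blast
      have w_mono: "V x \<le> V y \<Longrightarrow> w y \<le> w x" for x y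
        unfolding w_def using V[of x] by (intro ennreal_leI frac_le) auto
      have w_mono_a: "?a x < ?a y \<Longrightarrow> w y \<le> w x" for x y
        using V_increasing by (intro w_mono) (auto simp: increasing_wrt_def)
      \<comment> \<open>A site off \<open>B\<close> missing from \<open>S x y\<close> appears
        strictly later than \<open>x\<close> or than \<open>y\<close>, so \<open>V\<close> is at
        least as large there.\<close>
      have outer: "w z \<le> max (w x) (w y)" if "z \<in> - B - S x y" for z
        using that w_mono_a[of x z] w_mono_a[of y z] by (auto simp: S_def mem not_le le_max_iff_disj)
      \<comment> \<open>Choose whichever of \<open>x\<close> and \<open>y\<close> appears first, and
        the heavier one in a tie: it lies in both sets of the exhaustion and has the larger
        weight.\<close>
      obtain s where s: "s \<in> S x y" "s = x \<or> s = y" "w s = max (w x) (w y)"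
      proof (cases "?a x < ?a y \<or> ?a x = ?a y \<and> w y \<le> w x")
        case True
        then show thesis
          using xy w_mono_a[of x y] by (intro that[of x]) (auto simp: S_def mem max_def)
      next
        case False
        then show thesis
          using xy w_mono_a[of y x] by (intro that[of y]) (auto simp: S_def mem max_def)
      qed
      have "S x y \<subseteq> - B" by (auto simp: S_def)
      \<comment> \<open>\<open>majorant_le_loops\<close> has this constant on the right and
        \<open>cd\<close> on the left; their quotient is \<open>k\<close>. The estimates below are
        multiplied by \<open>cd\<close>, and the division takes place only in the reals.\<close>
      have "ennreal cd + ennreal Cstar + 1 = ennreal (cd + Cstar + 1)"
        using cd(1) Cstar_ge by simp
      with majorant_le_loops[OF \<open>S x y \<subseteq> - B\<close> outer s cdP, of n]
      have maj: "ennreal cd * majorant w (- B) n x y \<le> ennreal ((cd + Cstar + 1) * F n x y * \<mu> y)"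
        using em[of "cd + Cstar + 1" "F n x y" y] cd(1) Cstar_ge by (simp add: F(2) del: ennreal_plus)
      have "ennreal (cd * u n x y * \<mu> y) = ennreal cd * kpow Q n x y"
        using em[of cd "u n x y" y] cd(1) by (simp add: u(2))
      also have "\<dots> \<le> ennreal cd * (ennreal r * (ennreal lam0 ^ Suc n * f x * g y)
          + (3 * ennreal Cstar) ^ n * majorant w (- B) n x y)"
        by (intro mult_left_mono r xy) simp
      also have "\<dots> = ennreal cd * (ennreal r * ennreal (G n x y * \<mu> y))
          + (3 * ennreal Cstar) ^ n * (ennreal cd * majorant w (- B) n x y)"
        by (simp add: distrib_left mult.left_commute G(2) del: power_Suc)
      also have "\<dots> \<le> ennreal cd * (ennreal r * ennreal (G n x y * \<mu> y))
          + (3 * ennreal Cstar) ^ n * ennreal ((cd + Cstar + 1) * F n x y * \<mu> y)"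
        by (intro add_left_mono mult_left_mono maj) simp
      also have "\<dots> = ennreal ((cd * (r * G n x y) + (3 * Cstar) ^ n * ((cd + Cstar + 1) * F n x y)) * \<mu> y)"
      proof -
        have "3 * ennreal Cstar = ennreal (3 * Cstar)"
          using Cstar_ge by (simp add: ennreal_mult)
        then have pow: "(3 * ennreal Cstar) ^ n = ennreal ((3 * Cstar) ^ n)"
          using Cstar_ge by (simp only: ennreal_power)
        have "0 \<le> cd * (r * G n x y) * \<mu> y" "0 \<le> (3 * Cstar) ^ n * ((cd + Cstar + 1) * F n x y) * \<mu> y"
          "0 \<le> (3 * Cstar) ^ n" "0 \<le> cd"
          using cd(1) r(1) Cstar_ge G(1)[of n x y] F(1)[of n x y] \<mu>_pos[of y] by auto
        then show ?thesis
          using r(1) unfolding pow distrib_right[of "cd * (r * G n x y)"] by (simp only: em ennreal_plus)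
      qed
      finally have "cd * u n x y \<le> cd * (r * G n x y) + (3 * Cstar) ^ n * ((cd + Cstar + 1) * F n x y)"
        by (rule real_bound) (use cd(1) r(1) Cstar_ge G(1)[of n x y] F(1)[of n x y] in simp)
      also have "\<dots> = cd * (r * G n x y + k * ((3 * Cstar) ^ n * F n x y))"
        using cd(1) by (simp add: k_def field_simps)
      finally have "u n x y \<le> r * G n x y + k * ((3 * Cstar) ^ n * F n x y)"
        using cd(1) by (simp add: mult_le_cancel_left_pos)
      also have "(3 * Cstar) ^ n \<le> Cup ^ Suc n"
      proof -
        have "(3 * Cstar) ^ n \<le> (3 * Cstar) ^ Suc n"
          using Cstar_ge by (intro power_increasing) auto
        also have "\<dots> \<le> Cup ^ Suc n"
          using Cstar_ge by (intro power_mono) (auto simp: Cup_def)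
        finally show ?thesis .
      qed
      finally show ?thesis using k F(1)[of n x y] by (simp add: mult_left_mono mult_right_mono)
    qed
    with r(1) show thesis by (rule that)
  qed

  \<comment> \<open>One constant for all estimates\<close>
  define K where "K = c + d + e + k + 1"
  \<comment> \<open>\<open>c + 1\<close> arises in \<open>low_F\<close>: the ground state term is at
    most \<open>c * u\<close>, the term with \<open>F\<close> at most \<open>u\<close>.\<close>
  have K: "0 < K" "c \<le> K" "c + 1 \<le> K" "d \<le> K" "e \<le> K" "k \<le> K"
    using c(1) d(1) e(1) k by (auto simp: K_def)
  have low: "inverse K * G n x y \<le> u n x y" for n x y
  proof -
    have "G n x y \<le> K * u n x y"
      using c(2)[of n x y] mult_right_mono[OF K(2) u(1)[of n x y]] by linarith
    then show ?thesis using K(1) by (simp add: field_simps)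
  qed
  have up_B: "u n x y \<le> K * G n x y" if "x \<in> B \<or> y \<in> B" for n x y
    using d(2)[OF that, of n] mult_right_mono[OF K(4) G(1)[of n x y]] by linarith
  have low_F: "inverse K * (G n x y + Clow ^ Suc n * F n x y) \<le> u n x y" for n x y
  proof -
    have "G n x y + Clow ^ Suc n * F n x y \<le> (c + 1) * u n x y"
      using c(2)[of n x y] F_le[of n x y] by (simp add: algebra_simps)
    also have "\<dots> \<le> K * u n x y" by (intro mult_right_mono K u)
    finally show ?thesis using K(1) by (simp add: field_simps)
  qed
  have up_F: "u n x y \<le> K * (G n x y + Cup ^ Suc n * F n x y)" if "x \<in> - B \<and> y \<in> - B" for n x y
  proof -
    have "0 \<le> Cup ^ Suc n * F n x y" using Cstar_ge F(1)[of n x y] by (auto simp: Cup_def)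
    then have "e * G n x y + k * (Cup ^ Suc n * F n x y) \<le> K * G n x y + K * (Cup ^ Suc n * F n x y)"
      by (intro add_mono mult_right_mono K G)
    then show ?thesis using e(2)[of x y n] that by (simp add: distrib_left)
  qed
  show ?thesis
  proof (rule exI[of _ K], intro conjI allI impI)
    fix n x y assume "1 \<le> (n::nat)"
    then obtain m where n: "n = Suc m" by (cases n) auto
    \<comment> \<open>The same bound closes two goals, the lower half of (a) and the final
      claim.\<close>
    show "inverse K * lam0 ^ n * \<phi> x * \<phi>hat y \<le> fk_kernel \<mu> P V n x y"
      using low[of m x y] by (simp add: n u_def G_def mult.assoc)
    then show "inverse K * lam0 ^ n * \<phi> x * \<phi>hat y \<le> fk_kernel \<mu> P V n x y" .
    show "fk_kernel \<mu> P V n x y \<le> K * lam0 ^ n * \<phi> x * \<phi>hat y" if "x \<in> B \<or> y \<in> B"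
      using up_B[OF that, of m] by (simp add: n u_def G_def mult.assoc)
    show "inverse K * (lam0 ^ n * \<phi> x * \<phi>hat y
        + (min (inverse Cstar) (inf_diag P)) ^ n * F_term \<mu> P V A B n x y) \<le> fk_kernel \<mu> P V n x y"
      using low_F[of m x y] by (simp add: n u_def G_def F_def Clow_def cd_def)
    show "fk_kernel \<mu> P V n x y \<le> K * (lam0 ^ n * \<phi> x * \<phi>hat y
        + (max (3 * Cstar) (inverse (inf_diag P))) ^ n * F_term \<mu> P V A B n x y)" if "x \<in> - B \<and> y \<in> - B"
      using up_F[OF that, of m] by (simp add: n u_def G_def F_def Cup_def cd_def)
  qed (rule K)
qed

end
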